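(* The Ritter space $\hat{\mathbb{B}}$ is $n$-homogeneous for every positive integer $n$.
   Context: The Bing space $\mathbb{B}$ is the set $\{(x,y)\in\mathbb{Q}\times\mathbb{Q}: y\ge 0\}$ endowed with the topology consisting of all sets $U\subset\mathbb{B}$ such that for every $(a,b)\in U$ there exists $\varepsilon>0$ with $$\{(x,0)\in\mathbb{B}:|x-(a-b/\sqrt{3})|<\varepsilon\}\cup\{(x,0)\in\mathbb{B}:|x-(a+b/\sqrt{3})|<\varepsilon\}\subset U.$$ A subset $U$ of a topological space $X$ is regular open if $U$ coincides with the interior of its closure in $X$. The Ritter space $\hat{\mathbb{B}}$ is the set $\mathbb{B}$ endowed with the topology generated by the base consisting of all regular open subsets of the Bing space $\mathbb{B}$. A topological space $X$ is $n$-homogeneous, for a positive integer $n$, if any bijection $f:A\to B$ between $n$-element subsets $A,B$ of $X$ can be extended to a homeomorphism of $X$ onto itself. *)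

theory Defs
  imports "HOL-Analysis.Analysis"
begin

definition bing_set :: "(rat \<times> rat) set" where
  "bing_set = {(x, y). y \<ge> 0}"

definition bing_basic :: "real \<Rightarrow> real \<Rightarrow> (rat \<times> rat) set" where
  "bing_basic c \<epsilon> = {(x, y). (x, y) \<in> bing_set \<and> y = 0 \<and> \<bar>real_of_rat x - c\<bar> < \<epsilon>}"

definition bing_open :: "(rat \<times> rat) set \<Rightarrow> bool" where
  "bing_open U \<longleftrightarrow> U \<subseteq> bing_set \<and>
     (\<forall>(a, b)\<in>U. \<exists>\<epsilon>>0.
        bing_basic (real_of_rat a - real_of_rat b / sqrt 3) \<epsilon> \<union>
        bing_basic (real_of_rat a + real_of_rat b / sqrt 3) \<epsilon> \<subseteq> U)"

definition bing_space :: "(rat \<times> rat) topology" where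
  "bing_space = topology bing_open"

definition regular_openin :: "'a topology \<Rightarrow> 'a set \<Rightarrow> bool" where
  "regular_openin X U \<longleftrightarrow> U \<subseteq> topspace X \<and> U = X interior_of (X closure_of U)"

definition ritter_space :: "(rat \<times> rat) topology" where
  "ritter_space = topology (arbitrary union_of regular_openin bing_space)"

definition n_homogeneous :: "nat \<Rightarrow> 'a topology \<Rightarrow> bool" where
  "n_homogeneous n X \<longleftrightarrow>
     (\<forall>A B f. A \<subseteq> topspace X \<and> B \<subseteq> topspace X \<and>
        finite A \<and> finite B \<and> card A = n \<and> card B = n \<and> bij_betw f A B \<longrightarrow>
        (\<exists>h. homeomorphic_map X X h \<and> (\<forall>x\<in>A. h x = f x)))"

(* The type of topologies is total: the constructor yields an unspecified
   topology on a family that is not one.  The following facts rule this out. *)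

lemma bing_basic_mono: "\<epsilon> \<le> \<delta> \<Longrightarrow> bing_basic c \<epsilon> \<subseteq> bing_basic c \<delta>"
  by (auto simp: bing_basic_def)

lemma istopology_bing_open: "istopology bing_open"
  unfolding istopology_def
proof (intro conjI allI impI)
  fix S T assume S: "bing_open S" and T: "bing_open T"
  show "bing_open (S \<inter> T)"
    unfolding bing_open_def
  proof (intro conjI ballI, goal_cases)
    case 1
    show ?case using S by (auto simp: bing_open_def)
  next
    case (2 p)
    obtain a b where p: "p = (a, b)" by (cases p)
    let ?l = "real_of_rat a - real_of_rat b / sqrt 3"
    let ?r = "real_of_rat a + real_of_rat b / sqrt 3"
    from S 2 p obtain d where d: "d > 0" "bing_basic ?l d \<union> bing_basic ?r d \<subseteq> S"
      unfolding bing_open_def by blast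
    from T 2 p obtain e where e: "e > 0" "bing_basic ?l e \<union> bing_basic ?r e \<subseteq> T"
      unfolding bing_open_def by blast
    have "bing_basic c (min d e) \<subseteq> bing_basic c d \<inter> bing_basic c e" for c
      by (simp add: bing_basic_mono)
    then have "bing_basic ?l (min d e) \<union> bing_basic ?r (min d e) \<subseteq> S \<inter> T"
      using d(2) e(2) by blast
    moreover have "min d e > 0" using d e by simp
    ultimately show ?case unfolding p by blast
  qed
next
  fix K assume "\<forall>S\<in>K. bing_open S"
  then show "bing_open (\<Union>K)"
    unfolding bing_open_def by fast
qed

lemma openin_bing_space: "openin bing_space U \<longleftrightarrow> bing_open U"
  by (simp add: bing_space_def istopology_bing_open)

lemma topspace_bing_space [simp]: "topspace bing_space = bing_set"
proof -
  have "bing_open bing_set"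
    by (auto simp: bing_open_def bing_basic_def intro: exI [of _ 1])
  then show ?thesis
    by (auto simp: topspace_def openin_bing_space bing_open_def)
qed

lemma regular_openin_Int:
  assumes "regular_openin X S" "regular_openin X T"
  shows "regular_openin X (S \<inter> T)"
proof -
  have "X interior_of (X closure_of (S \<inter> T)) \<subseteq> S \<inter> T"
    using assms unfolding regular_openin_def
    by (metis Int_lower1 Int_lower2 closure_of_mono interior_of_mono le_inf_iff)
  moreover have "S \<inter> T \<subseteq> X interior_of (X closure_of (S \<inter> T))"
    using assms unfolding regular_openin_def
    by (metis closure_of_subset interior_of_maximal le_infI1 openin_Int openin_interior_of)
  ultimately show ?thesis
    using assms unfolding regular_openin_def by blast
qed

lemma openin_ritter_space:
  "openin ritter_space U \<longleftrightarrow> (arbitrary union_of regular_openin bing_space) U"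
  by (simp add: ritter_space_def istopology_base regular_openin_Int)

lemma topspace_ritter_space [simp]: "topspace ritter_space = bing_set"
proof
  show "topspace ritter_space \<subseteq> bing_set"
    by (auto simp: topspace_def openin_ritter_space arbitrary_union_of_alt regular_openin_def)
       (metis openin_interior_of openin_subset subsetD topspace_bing_space)
  have "regular_openin bing_space bing_set"
    unfolding regular_openin_def
    by (metis closure_of_topspace interior_of_topspace order_refl topspace_bing_space)
  then show "bing_set \<subseteq> topspace ritter_space"
    by (metis arbitrary_union_of_inc openin_ritter_space openin_subset)
qed

end

theory Submission
  imports Defs
begin

text \<open>
  Sending \<open>(a, b)\<close> to \<open>a + b/\<surd>3\<close> identifies the points of the Ritter space with the orbits
  \<open>{z, \<sigma> z}\<close> of the conjugation \<open>\<sigma>\<close> on the dense subfield \<open>\<rat>(\<surd>3)\<close> of the line, and the basic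
  neighbourhoods of an orbit become the sets of all orbits contained in a given open set.
  This topology does not change if finitely many orbits are collapsed to points: after collapsing
  the orbits in a finite set \<open>A\<close>, every point of \<open>A\<close> is a fixed point of the involution, exactly like
  a point of the axis. The collapsed space is still countable, zero-dimensional and second
  countable, its fixed points are dense, and so is the graph of the involution in the square.
  Any two such spaces are equivariantly homeomorphic by a back-and-forth argument, with
  prescribed values on a finite set of fixed points. Applied to the collapses of \<open>A\<close> and of \<open>B\<close>,
  this extends a given bijection from \<open>A\<close> to \<open>B\<close>.
\<close>

subsection \<open>Back-and-forth for zero-dimensional spaces with an involution\<close>

text \<open>Of the topology only a Boolean algebra of clopen sets is kept. Nothing relates
  \<open>\<sigma>\<close> to \<open>\<C>\<close> by continuity; on the contrary,
  \<open>moved_dense\<close> says that a point and its mirror image can be placed independently, and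
  this freedom drives the construction.\<close>

locale involution_space =
  fixes E :: "'a set" and \<sigma> :: "'a \<Rightarrow> 'a" and \<C> :: "'a set set"
  assumes countable_points: "countable E"
    and nonempty: "E \<noteq> {}"
    and clopen_subset: "U \<in> \<C> \<Longrightarrow> U \<subseteq> E"
    and clopen_whole: "E \<in> \<C>"
    and clopen_compl: "U \<in> \<C> \<Longrightarrow> E - U \<in> \<C>"
    and clopen_Int: "U \<in> \<C> \<Longrightarrow> V \<in> \<C> \<Longrightarrow> U \<inter> V \<in> \<C>"
    and clopen_isolate: "x \<in> E \<Longrightarrow> finite F \<Longrightarrow> \<exists>U\<in>\<C>. x \<in> U \<and> U \<inter> F \<subseteq> {x}"
    and involution_closed: "x \<in> E \<Longrightarrow> \<sigma> x \<in> E"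
    and involution: "x \<in> E \<Longrightarrow> \<sigma> (\<sigma> x) = x"
    and fixed_dense: "U \<in> \<C> \<Longrightarrow> U \<noteq> {} \<Longrightarrow> finite F \<Longrightarrow> \<exists>x\<in>U - F. \<sigma> x = x"
    and moved_dense: "U \<in> \<C> \<Longrightarrow> V \<in> \<C> \<Longrightarrow> U \<noteq> {} \<Longrightarrow> V \<noteq> {} \<Longrightarrow> finite F \<Longrightarrow>
      \<exists>x\<in>U - F. \<sigma> x \<in> V \<and> \<sigma> x \<noteq> x"
begin

lemma clopen_Un:
  assumes "U \<in> \<C>" "V \<in> \<C>"
  shows "U \<union> V \<in> \<C>"
proof -
  have "U \<union> V = E - (E - U) \<inter> (E - V)"
    using assms clopen_subset by blast
  then show ?thesis
    using assms clopen_compl clopen_Int by simp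
qed

lemma clopen_separate:
  assumes "finite Y" "Y \<subseteq> E" "finite F" "Y \<inter> F = {}"
  shows "\<exists>U\<in>\<C>. Y \<subseteq> U \<and> U \<inter> F = {}"
  using assms
proof (induction Y rule: finite_induct)
  case empty
  have "{} \<in> \<C>"
    using clopen_compl [OF clopen_whole] by simp
  then show ?case by blast
next
  case (insert y Y)
  then obtain U where U: "U \<in> \<C>" "Y \<subseteq> U" "U \<inter> F = {}" by auto
  from insert obtain V where "V \<in> \<C>" "y \<in> V" "V \<inter> F \<subseteq> {y}"
    using clopen_isolate by (metis insert_subset)
  with U insert.prems show ?case
    by (intro bexI [of _ "U \<union> V"] clopen_Un) auto
qed

text \<open>Such a set is a Boolean combination of the finitely many \<open>c l\<close>. The
  predicate is generalised in the induction because inside \<open>c k\<close> it has to be replaced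
  by \<open>\<lambda>K. P (insert k K)\<close>.\<close>

lemma clopen_pattern:
  assumes "finite L" "\<And>l. l \<in> L \<Longrightarrow> c l \<in> \<C>"
  shows "{y \<in> E. P {l \<in> L. y \<in> c l}} \<in> \<C>"
  using assms
proof (induction L arbitrary: P rule: finite_induct)
  case empty
  have "{} \<in> \<C>"
    using clopen_compl [OF clopen_whole] by simp
  then show ?case
    using clopen_whole by (cases "P {}") auto
next
  case (insert k L)
  let ?in = "{y \<in> E. P (insert k {l \<in> L. y \<in> c l})}"
  let ?out = "{y \<in> E. P {l \<in> L. y \<in> c l}}"
  have "{l \<in> insert k L. y \<in> c l} =
      (if y \<in> c k then insert k {l \<in> L. y \<in> c l} else {l \<in> L. y \<in> c l})" for y
    by auto
  then have "{y \<in> E. P {l \<in> insert k L. y \<in> c l}} = c k \<inter> ?in \<union> (E - c k) \<inter> ?out"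
    using clopen_subset insert.prems by auto
  moreover have "?in \<in> \<C>" "?out \<in> \<C>"
    using insert.IH [of "\<lambda>K. P (insert k K)"] insert.IH [of P] insert.prems by auto
  ultimately show ?case
    using insert.prems clopen_Un clopen_Int clopen_compl by simp
qed

end

section \<open>Finite approximations to an equivariant homeomorphism\<close>

definition linked :: "('a set \<times> 'b set) set \<Rightarrow> 'a \<Rightarrow> 'b \<Rightarrow> bool" where
  "linked L x y \<longleftrightarrow> (\<forall>(U, V)\<in>L. x \<in> U \<longleftrightarrow> y \<in> V)"

lemma linked_pattern: "linked L x y \<longleftrightarrow> {l \<in> L. x \<in> fst l} = {l \<in> L. y \<in> snd l}"
  unfolding linked_def set_eq_iff by (auto split: prod.splits)

lemma linked_converse: "linked (L\<inverse>) y x \<longleftrightarrow> linked L x y"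
  by (auto simp: linked_def)

locale back_and_forth =
  X: involution_space E \<sigma> \<C> + Y: involution_space E' \<sigma>' \<C>'
  for E :: "'a set" and \<sigma> \<C> and E' :: "'b set" and \<sigma>' \<C>'
begin

text \<open>A pair in \<open>G\<close> is a decided value of the bijection, a pair
  \<open>(U, V)\<close> in \<open>L\<close> a promise that \<open>U\<close> will be mapped onto
  \<open>V\<close>. The last two conditions say that the promises cut both spaces into matching
  nonempty atoms; otherwise some point could never receive a partner.\<close>

definition approx :: "('a set \<times> 'b set) set \<Rightarrow> ('a \<times> 'b) set \<Rightarrow> bool" where
  "approx L G \<longleftrightarrow> finite L \<and> finite G \<and> L \<subseteq> \<C> \<times> \<C>' \<and> G \<subseteq> E \<times> E' \<and>
     (\<forall>(x, y)\<in>G. (\<sigma> x, \<sigma>' y) \<in> G \<and> linked L x y) \<and>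
     (\<forall>(x, y)\<in>G. \<forall>(u, v)\<in>G. x = u \<longleftrightarrow> y = v) \<and>
     (\<forall>x\<in>E. \<exists>y\<in>E'. linked L x y) \<and> (\<forall>y\<in>E'. \<exists>x\<in>E. linked L x y)"

lemma approxD:
  assumes "approx L G"
  shows "finite L" "finite G" "L \<subseteq> \<C> \<times> \<C>'" "G \<subseteq> E \<times> E'"
    and "\<And>x y. (x, y) \<in> G \<Longrightarrow> (\<sigma> x, \<sigma>' y) \<in> G"
    and "\<And>x y. (x, y) \<in> G \<Longrightarrow> linked L x y"
    and "\<And>x y u v. (x, y) \<in> G \<Longrightarrow> (u, v) \<in> G \<Longrightarrow> x = u \<longleftrightarrow> y = v"
    and "\<And>x. x \<in> E \<Longrightarrow> \<exists>y\<in>E'. linked L x y"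
    and "\<And>y. y \<in> E' \<Longrightarrow> \<exists>x\<in>E. linked L x y"
  using assms unfolding approx_def by (simp, simp, simp, simp, fast, fast, fast, fast, fast)

text \<open>By this symmetry each extension step has to be proved in one direction only.\<close>

lemma approx_converse:
  assumes "approx L G"
  shows "back_and_forth.approx E' \<sigma>' \<C>' E \<sigma> \<C> (L\<inverse>) (G\<inverse>)"
proof -
  interpret swap: back_and_forth E' \<sigma>' \<C>' E \<sigma> \<C> ..
  show ?thesis
    using assms unfolding approx_def swap.approx_def linked_converse by fast
qed

lemma saturated_clopen:
  assumes "approx L G"
  shows "{y \<in> E'. P {l \<in> L. y \<in> snd l}} \<in> \<C>'"
  using assms by (intro Y.clopen_pattern) (auto simp: approx_def)

text \<open>The partner \<open>y\<close> must lie in the atom matching \<open>x\<close> while its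
  mirror image lies in the atom matching \<open>\<sigma> x\<close>. Density of the fixed points, or
  of the graph of the involution, provides such a \<open>y\<close> away from the finitely many
  values already used.\<close>

lemma extend_point:
  assumes ap: "approx L G" and x: "x \<in> E"
  shows "\<exists>G'. G \<subseteq> G' \<and> approx L G' \<and> x \<in> Domain G'"
proof (cases "x \<in> Domain G")
  case True
  then show ?thesis using ap by blast
next
  case False
  note ap' = approxD [OF ap]
  have sx: "\<sigma> x \<in> E" "\<sigma> (\<sigma> x) = x"
    using x X.involution_closed X.involution by auto
  have False2: "\<sigma> x \<notin> Domain G"
    using False ap'(5) [of "\<sigma> x"] sx by auto
  define atom where "atom u = {y \<in> E'. linked L u y}" for u
  have atom: "atom u \<in> \<C>'" for u
    unfolding atom_def linked_pattern
    using saturated_clopen [OF ap, of "\<lambda>K. {l \<in> L. u \<in> fst l} = K"] .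
  have atom_ne: "atom u \<noteq> {}" if "u \<in> E" for u
    using ap'(8) [OF that] unfolding atom_def by blast
  have fin: "finite (Range G)"
    using ap' by (simp add: finite_Range)
  obtain y where y: "y \<in> atom x" "y \<notin> Range G" "\<sigma>' y \<in> atom (\<sigma> x)" "\<sigma>' y = y \<longleftrightarrow> \<sigma> x = x"
  proof (cases "\<sigma> x = x")
    case True
    with Y.fixed_dense [OF atom atom_ne [OF x] fin] that show thesis by auto
  next
    case False
    with Y.moved_dense [OF atom atom atom_ne [OF x] atom_ne [OF sx(1)] fin] that show thesis
      by auto
  qed
  have yE: "y \<in> E'" "linked L x y" "linked L (\<sigma> x) (\<sigma>' y)"
    using y by (auto simp: atom_def)
  have sy: "\<sigma>' y \<in> E'" "\<sigma>' (\<sigma>' y) = y"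
    using yE Y.involution_closed Y.involution by auto
  have "\<sigma>' y \<notin> Range G"
    using y(2) ap'(4) ap'(5) [of _ "\<sigma>' y"] sy by auto
  moreover define G' where "G' = G \<union> {(x, y), (\<sigma> x, \<sigma>' y)}"
  ultimately have "\<forall>(x, y)\<in>G'. \<forall>(u, v)\<in>G'. x = u \<longleftrightarrow> y = v"
    using y(2,4) False False2 by (auto dest: ap'(7))
  moreover have "\<forall>(x, y)\<in>G'. (\<sigma> x, \<sigma>' y) \<in> G' \<and> linked L x y"
    using ap'(5,6) yE sx sy by (auto simp: G'_def)
  moreover have "G' \<subseteq> E \<times> E'" "finite G'"
    using ap'(2,4) x yE sx sy by (auto simp: G'_def)
  ultimately have "approx L G'"
    using ap'(1,3,8,9) unfolding approx_def by simp
  then show ?thesis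
    by (intro exI [of _ G']) (auto simp: G'_def)
qed

lemma extend_points:
  assumes "finite R" "R \<subseteq> E" "approx L G"
  shows "\<exists>G'. G \<subseteq> G' \<and> approx L G' \<and> R \<subseteq> Domain G'"
  using assms
proof (induction R rule: finite_induct)
  case empty
  then show ?case by auto
next
  case (insert x R)
  then obtain G' where G': "G \<subseteq> G'" "approx L G'" "R \<subseteq> Domain G'" by auto
  with insert.prems obtain G'' where "G' \<subseteq> G''" "approx L G''" "x \<in> Domain G''"
    using extend_point by (metis insert_subset)
  with G' show ?case
    by (intro exI [of _ G'']) blast
qed

text \<open>The danger is a set \<open>V\<close> that leaves a part of an atom empty on one side
  only. Hence one point from every nonempty part that \<open>U\<close> cuts out of an atom first
  receives a partner; any \<open>V\<close> that respects these pairs has points wherever they are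
  needed.\<close>

lemma extend_clopen:
  assumes ap: "approx L G" and U: "U \<in> \<C>"
  shows "\<exists>L' G'. L \<subseteq> L' \<and> G \<subseteq> G' \<and> approx L' G' \<and> U \<in> Domain L'"
proof -
  have "finite L" using ap by (simp add: approx_def)
  \<comment> \<open>The value of \<open>cell\<close> names the part containing \<open>x\<close>.
    There are finitely many values, so a finite \<open>R\<close> represents all parts.\<close>
  define cell where "cell x = ({l \<in> L. x \<in> fst l}, x \<in> U)" for x
  have "cell ` E \<subseteq> Pow L \<times> UNIV" by (auto simp: cell_def)
  then have "finite (cell ` E)"
    using \<open>finite L\<close> by (auto elim: finite_subset)
  then obtain R where R: "finite R" "R \<subseteq> E" "cell ` E = cell ` R"
    by (meson finite_subset_image order_refl)
  obtain G' where G': "G \<subseteq> G'" "approx L G'" "R \<subseteq> Domain G'"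
    using extend_points [OF R(1,2) ap] by blast
  note ap' = approxD [OF G'(2)]
  \<comment> \<open>\<open>T\<close> below settles the points of \<open>G'\<close>; \<open>In\<close> and \<open>Out\<close> correct it on the atoms of \<open>L\<close> that
    \<open>U\<close> does not split. Every part of a split atom has a witness in \<open>G'\<close>.\<close>
  define In where "In = {y \<in> E'. \<forall>x\<in>E. linked L x y \<longrightarrow> x \<in> U}"
  define Out where "Out = {y \<in> E'. \<exists>x\<in>E. linked L x y \<and> x \<in> U}"
  have In: "In \<in> \<C>'"
    unfolding In_def linked_pattern
    using saturated_clopen [OF ap, of "\<lambda>K. \<forall>x\<in>E. {l \<in> L. x \<in> fst l} = K \<longrightarrow> x \<in> U"] .
  have Out: "Out \<in> \<C>'"
    unfolding Out_def linked_pattern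
    using saturated_clopen [OF ap, of "\<lambda>K. \<exists>x\<in>E. {l \<in> L. x \<in> fst l} = K \<and> x \<in> U"] .
  have "G' `` U \<inter> G' `` (- U) = {}"
    using ap'(7) by blast
  moreover have "finite (G' `` U)" "finite (G' `` (- U))" "G' `` U \<subseteq> E'"
    using ap'(2,4) by (auto intro: finite_Image)
  ultimately obtain T where T: "T \<in> \<C>'" "G' `` U \<subseteq> T" "T \<inter> G' `` (- U) = {}"
    using Y.clopen_separate by metis
  define V where "V = (T \<union> In) \<inter> Out"
  have V: "V \<in> \<C>'"
    unfolding V_def using T(1) In Out Y.clopen_Un Y.clopen_Int by simp
  define L' where "L' = insert (U, V) L"
  have linked': "linked L' x y \<longleftrightarrow> linked L x y \<and> (x \<in> U \<longleftrightarrow> y \<in> V)" for x y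
    by (auto simp: L'_def linked_def)
  have link: "linked L' x y" if "(x, y) \<in> G'" for x y
  proof -
    have xy: "x \<in> E" "y \<in> E'" "linked L x y" using ap'(4,6) that by auto
    have "y \<in> V" if "x \<in> U"
      using T(2) xy that \<open>(x, y) \<in> G'\<close> by (auto simp: V_def Out_def)
    moreover have "y \<notin> V" if "x \<notin> U"
      using T(3) xy that \<open>(x, y) \<in> G'\<close> by (auto simp: V_def In_def)
    ultimately show ?thesis using xy linked' by blast
  qed
  have forward: "\<exists>y\<in>E'. linked L' x y" if "x \<in> E" for x
  proof -
    have "cell x \<in> cell ` R" using R(3) that by blast
    then obtain r where r: "r \<in> R" "cell x = cell r" by blast
    then obtain y where y: "(r, y) \<in> G'" using G'(3) by blast
    then have "linked L' r y" "y \<in> E'" using link ap'(4) by auto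
    moreover have "linked L' x y \<longleftrightarrow> linked L' r y"
      using r(2) by (simp add: linked' linked_pattern [of L] cell_def)
    ultimately show ?thesis by blast
  qed
  have backward: "\<exists>x\<in>E. linked L' x y" if y: "y \<in> E'" for y
  proof (cases "y \<in> V")
    case True
    then show ?thesis by (auto simp: V_def Out_def linked')
  next
    case False
    \<comment> \<open>Outside \<open>Out\<close> every linked point avoids \<open>U\<close>, and one
      exists by the old approximation; outside \<open>In\<close> some linked point avoids
      \<open>U\<close> by definition.\<close>
    then consider "y \<notin> Out" | "y \<notin> In" by (auto simp: V_def)
    then show ?thesis
    proof cases
      case 1
      then show ?thesis
        using ap'(9) [OF y] y False unfolding Out_def linked' by blast
    next
      case 2
      then show ?thesis
        using y False unfolding In_def linked' by blast
    qed
  qed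
  have "approx L' G'"
    using ap'(1-5) U V link forward backward unfolding approx_def
    by (auto simp: L'_def dest: ap'(7))
  then show ?thesis
    using G'(1) by (intro exI [of _ L'] exI [of _ G']) (auto simp: L'_def)
qed

lemma extend:
  assumes "approx L G" "x \<in> E" "U \<in> \<C>" "y \<in> E'" "V \<in> \<C>'"
  shows "\<exists>L' G'. L \<subseteq> L' \<and> G \<subseteq> G' \<and> approx L' G' \<and>
    x \<in> Domain G' \<and> U \<in> Domain L' \<and> y \<in> Range G' \<and> V \<in> Range L'"
proof -
  interpret swap: back_and_forth E' \<sigma>' \<C>' E \<sigma> \<C> ..
  obtain G1 where 1: "G \<subseteq> G1" "approx L G1" "x \<in> Domain G1"
    using assms extend_point by blast
  obtain L2 G2 where 2: "L \<subseteq> L2" "G1 \<subseteq> G2" "approx L2 G2" "U \<in> Domain L2"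
    using extend_clopen [OF 1(2) assms(3)] by blast
  obtain G3 where 3: "G2\<inverse> \<subseteq> G3" "swap.approx (L2\<inverse>) G3" "y \<in> Domain G3"
    using swap.extend_point [OF approx_converse [OF 2(3)] assms(4)] by blast
  obtain L4 G4 where 4: "L2\<inverse> \<subseteq> L4" "G3 \<subseteq> G4" "swap.approx L4 G4" "V \<in> Domain L4"
    using swap.extend_clopen [OF 3(2) assms(5)] by blast
  have "approx (L4\<inverse>) (G4\<inverse>)"
    using swap.approx_converse [OF 4(3)] .
  moreover have "L2 \<subseteq> L4\<inverse>" "G2 \<subseteq> G4\<inverse>" "y \<in> Range (G4\<inverse>)" "V \<in> Range (L4\<inverse>)"
    using 3(1,3) 4(1,2,4) by auto
  moreover have "L \<subseteq> L4\<inverse>" "G \<subseteq> G4\<inverse>" "x \<in> Domain (G4\<inverse>)" "U \<in> Domain (L4\<inverse>)"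
    using 1(1,3) 2(1,2,4) calculation(2,3) by blast+
  ultimately show ?thesis by blast
qed

text \<open>Stage \<open>n\<close> treats the \<open>n\<close>-th point of each space and the
  \<open>n\<close>-th member of each family. The union of the graphs is then an equivariant
  bijection, and it keeps every promise ever made. With countably many stages only countable
  families can be handled, which is enough if they are bases.\<close>

theorem equivariant_bijection:
  assumes f: "f ` A \<subseteq> E'" "inj_on f A" and A: "finite A" "A \<subseteq> E"
    and fixed: "\<And>a. a \<in> A \<Longrightarrow> \<sigma> a = a" "\<And>a. a \<in> A \<Longrightarrow> \<sigma>' (f a) = f a"
    and S: "countable \<S>" "\<S> \<subseteq> \<C>" and S': "countable \<S>'" "\<S>' \<subseteq> \<C>'"
  obtains g where "bij_betw g E E'" "\<And>x. x \<in> E \<Longrightarrow> g (\<sigma> x) = \<sigma>' (g x)"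
    "\<And>a. a \<in> A \<Longrightarrow> g a = f a"
    "\<And>U. U \<in> \<S> \<Longrightarrow> g ` U \<in> \<C>'" "\<And>V. V \<in> \<S>' \<Longrightarrow> {x \<in> E. g x \<in> V} \<in> \<C>"
proof -
  \<comment> \<open>\<open>from_nat_into\<close> stays inside a set only if that set is nonempty;
    for this reason \<open>insert E \<S>\<close> is enumerated in place of
    \<open>\<S>\<close>.\<close>
  let ?enum = "\<lambda>S n. from_nat_into S (n::nat)"
  have enum: "?enum E n \<in> E" "?enum E' n \<in> E'" "?enum (insert E \<S>) n \<in> \<C>"
    "?enum (insert E' \<S>') n \<in> \<C>'" for n
    using X.nonempty Y.nonempty S S' X.clopen_whole Y.clopen_whole
      from_nat_into [of E n] from_nat_into [of E' n]
      from_nat_into [of "insert E \<S>" n] from_nat_into [of "insert E' \<S>'" n] by auto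
  \<comment> \<open>The prescribed values are an admissible start: \<open>a\<close> and
    \<open>f a\<close> are fixed points, so \<open>G0\<close> is closed under the two
    involutions.\<close>
  define G0 where "G0 = (\<lambda>a. (a, f a)) ` A"
  have "approx {} G0"
    using f A fixed X.nonempty Y.nonempty
    by (auto simp: approx_def linked_def G0_def inj_on_eq_iff)
  define step where "step n p q \<longleftrightarrow> fst p \<subseteq> fst q \<and> snd p \<subseteq> snd q \<and>
      ?enum E n \<in> Domain (snd q) \<and> ?enum (insert E \<S>) n \<in> Domain (fst q) \<and>
      ?enum E' n \<in> Range (snd q) \<and> ?enum (insert E' \<S>') n \<in> Range (fst q)" for n p q
  \<comment> \<open>The clause for \<open>n = 0\<close> carries the starting value through the
    dependent choice.\<close>
  have "\<exists>c. \<forall>n. (approx (fst (c n)) (snd (c n)) \<and> (n = 0 \<longrightarrow> c n = ({}, G0))) \<and> step n (c n) (c (Suc n))"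
  proof (rule dependent_nat_choice)
    show "\<exists>p. approx (fst p) (snd p) \<and> (0 = (0::nat) \<longrightarrow> p = ({}, G0))"
      using \<open>approx {} G0\<close> by auto
  next
    fix p and n :: nat
    assume "approx (fst p) (snd p) \<and> (n = 0 \<longrightarrow> p = ({}, G0))"
    with extend [of "fst p" "snd p", OF _ enum(1,3,2,4)]
    show "\<exists>q. (approx (fst q) (snd q) \<and> (Suc n = 0 \<longrightarrow> q = ({}, G0))) \<and> step n p q"
      unfolding step_def by fastforce
  qed
  then obtain c where c: "\<And>n. approx (fst (c n)) (snd (c n))" "c 0 = ({}, G0)"
      "\<And>n. step n (c n) (c (Suc n))"
    by blast
  have mono: "fst (c m) \<subseteq> fst (c n)" "snd (c m) \<subseteq> snd (c n)" if "m \<le> n" for m n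
    using c(3) lift_Suc_mono_le [of "\<lambda>n. fst (c n)" m n] lift_Suc_mono_le [of "\<lambda>n. snd (c n)" m n] that
    by (auto simp: step_def)
  define L where "L = (\<Union>n. fst (c n))"
  define G where "G = (\<Union>n. snd (c n))"
  have L: "L \<subseteq> \<C> \<times> \<C>'" and G: "G \<subseteq> E \<times> E'"
    using approxD(3,4) [OF c(1)] by (auto simp: L_def G_def)
  have G_equi: "(\<sigma> x, \<sigma>' y) \<in> G" if "(x, y) \<in> G" for x y
    using approxD(5) [OF c(1)] that by (auto simp: G_def)
  have G_inj: "x = u \<longleftrightarrow> y = v" if "(x, y) \<in> G" "(u, v) \<in> G" for x y u v
  proof -
    from that obtain m n where "(x, y) \<in> snd (c m)" "(u, v) \<in> snd (c n)"
      by (auto simp: G_def)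
    then have "(x, y) \<in> snd (c (max m n))" "(u, v) \<in> snd (c (max m n))"
      using mono(2) [of m "max m n"] mono(2) [of n "max m n"] by auto
    then show ?thesis
      using approxD(7) [OF c(1)] by blast
  qed
  have G_linked: "x \<in> U \<longleftrightarrow> y \<in> V" if "(x, y) \<in> G" "(U, V) \<in> L" for x y U V
  proof -
    from that obtain m n where "(x, y) \<in> snd (c m)" "(U, V) \<in> fst (c n)"
      by (auto simp: G_def L_def)
    \<comment> \<open>A value and a promise made at different stages meet in one later
      approximation, where they are compatible.\<close>
    then have "(x, y) \<in> snd (c (max m n))" "(U, V) \<in> fst (c (max m n))"
      using mono(2) [of m "max m n"] mono(1) [of n "max m n"] by auto
    then show ?thesis
      using approxD(6) [OF c(1)] unfolding linked_def by blast
  qed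
  have "E \<subseteq> Domain G"
  proof
    fix x assume "x \<in> E"
    then obtain n where "x = ?enum E n"
      using X.countable_points by (metis from_nat_into_to_nat_on)
    then show "x \<in> Domain G"
      using c(3) [of n] unfolding step_def G_def by blast
  qed
  have "E' \<subseteq> Range G"
  proof
    fix y assume "y \<in> E'"
    then obtain n where "y = ?enum E' n"
      using Y.countable_points by (metis from_nat_into_to_nat_on)
    then show "y \<in> Range G"
      using c(3) [of n] unfolding step_def G_def by blast
  qed
  have "\<S> \<subseteq> Domain L"
  proof
    fix U assume "U \<in> \<S>"
    then obtain n where "U = ?enum (insert E \<S>) n"
      using S(1) by (metis countable_insert from_nat_into_to_nat_on insertI2)
    then show "U \<in> Domain L"
      using c(3) [of n] unfolding step_def L_def by blast
  qed
  have "\<S>' \<subseteq> Range L"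
  proof
    fix V assume "V \<in> \<S>'"
    then obtain n where "V = ?enum (insert E' \<S>') n"
      using S'(1) by (metis countable_insert from_nat_into_to_nat_on insertI2)
    then show "V \<in> Range L"
      using c(3) [of n] unfolding step_def L_def by blast
  qed
  define g where "g x = (SOME y. (x, y) \<in> G)" for x
  have g: "(x, g x) \<in> G" if "x \<in> E" for x
    using \<open>E \<subseteq> Domain G\<close> that unfolding g_def by (metis DomainE someI subsetD)
  have gE: "g x \<in> E'" if "x \<in> E" for x
    using g [OF that] G by blast
  have g_eq: "g x = y" if "(x, y) \<in> G" for x y
    using g [of x] G_inj [of x "g x" x y] that G by blast
  have g_onto: "\<exists>x\<in>E. g x = y" if "y \<in> E'" for y
    using \<open>E' \<subseteq> Range G\<close> that g_eq G by blast
  show thesis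
  proof
    show "bij_betw g E E'"
      unfolding bij_betw_def inj_on_def using g gE g_onto G_inj by blast
    show "g (\<sigma> x) = \<sigma>' (g x)" if "x \<in> E" for x
      using g_eq [OF G_equi [OF g [OF that]]] .
    show "g a = f a" if "a \<in> A" for a
    proof -
      have "(a, f a) \<in> snd (c 0)" using c(2) that by (simp add: G0_def)
      then show ?thesis using g_eq by (auto simp: G_def)
    qed
    show "g ` U \<in> \<C>'" if "U \<in> \<S>" for U
    proof -
      from that \<open>\<S> \<subseteq> Domain L\<close> obtain V where V: "(U, V) \<in> L" by blast
      then have UV: "U \<subseteq> E" "V \<subseteq> E'" "V \<in> \<C>'"
        using L X.clopen_subset Y.clopen_subset by blast+
      have "g ` U = V"
      proof (intro equalityI subsetI)
        fix y assume "y \<in> g ` U"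
        then show "y \<in> V" using G_linked [OF g V] UV by blast
      next
        fix y assume "y \<in> V"
        then obtain x where "x \<in> E" "g x = y" using g_onto UV by blast
        then show "y \<in> g ` U" using G_linked [OF g V] \<open>y \<in> V\<close> by blast
      qed
      then show ?thesis using UV by simp
    qed
    show "{x \<in> E. g x \<in> V} \<in> \<C>" if "V \<in> \<S>'" for V
    proof -
      from that \<open>\<S>' \<subseteq> Range L\<close> obtain U where U: "(U, V) \<in> L" by blast
      then have "U \<subseteq> E" "U \<in> \<C>" using L X.clopen_subset by blast+
      moreover have "{x \<in> E. g x \<in> V} = U"
        using G_linked [OF g U] \<open>U \<subseteq> E\<close> by blast
      ultimately show ?thesis by simp
    qed
  qed
qed

end

subsection \<open>The Ritter space as a space of conjugation orbits\<close>

text \<open>This is defined on the whole plane, which thereby becomes the field of numbers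
  \<open>a + b / sqrt 3\<close>. The half-plane \<open>bing_set\<close> contains exactly one point
  of each conjugation orbit.\<close>

definition val :: "rat \<times> rat \<Rightarrow> real" where
  "val p = real_of_rat (fst p) + real_of_rat (snd p) / sqrt 3"

definition conjugate :: "rat \<times> rat \<Rightarrow> rat \<times> rat" where
  "conjugate p = (fst p, - snd p)"

lemma conjugate_conjugate [simp]: "conjugate (conjugate p) = p"
  by (simp add: conjugate_def)

lemma conjugate_eq_self: "conjugate p = p \<longleftrightarrow> snd p = 0"
  by (auto simp: conjugate_def prod_eq_iff)

lemma mem_bing_set: "p \<in> bing_set \<longleftrightarrow> snd p \<ge> 0"
  by (auto simp: bing_set_def)

lemma rat_square_neq_3: "(q::rat)\<^sup>2 \<noteq> 3"
proof
  assume q: "q\<^sup>2 = 3"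
  obtain a b where ab: "quotient_of q = (a, b)" by fastforce
  have b: "b > 0" "coprime a b" "q = of_int a / of_int b"
    using ab by (auto intro: quotient_of_denom_pos quotient_of_coprime quotient_of_div)
  then have "of_int a = q * of_int b"
    by simp
  then have "(of_int a)\<^sup>2 = (3 * (of_int b)\<^sup>2 :: rat)"
    using q by (simp add: power_mult_distrib)
  then have eq: "a\<^sup>2 = 3 * b\<^sup>2"
    by (metis of_int_eq_iff of_int_mult of_int_numeral of_int_power)
  have "prime (3::int)" by simp
  then have dvd3: "3 dvd c" if "3 dvd c\<^sup>2" for c :: int
    using prime_dvd_power that by blast
  have "3 dvd a" using dvd3 eq by simp
  then obtain c where "a = 3 * c" by blast
  with eq have "b\<^sup>2 = 3 * c\<^sup>2" by (simp add: power2_eq_square)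
  then have "3 dvd b" using dvd3 by simp
  with \<open>3 dvd a\<close> \<open>coprime a b\<close> show False
    by (metis coprime_common_divisor_int abs_numeral numeral_eq_one_iff semiring_norm(84))
qed

lemma inj_val: "inj val"
proof
  fix p q assume eq: "val p = val q"
  have "snd p = snd q"
  proof (rule ccontr)
    assume ne: "snd p \<noteq> snd q"
    \<comment> \<open>Solving \<open>val p = val q\<close> for \<open>sqrt 3\<close> gives this
      rational number.\<close>
    define r where "r = (snd q - snd p) / (fst p - fst q)"
    have *: "real_of_rat (fst p - fst q) * sqrt 3 = real_of_rat (snd q - snd p)"
      using eq by (simp add: val_def field_simps of_rat_diff)
    then have "fst p - fst q \<noteq> 0"
      using ne by (metis eq_iff_diff_eq_0 mult_zero_left of_rat_0 of_rat_eq_iff)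
    then have "real_of_rat r = sqrt 3"
      using * unfolding r_def by (simp add: of_rat_divide field_simps)
    then have "real_of_rat (r\<^sup>2) = real_of_rat 3"
      by (simp add: of_rat_power)
    then show False
      using rat_square_neq_3 of_rat_eq_iff by blast
  qed
  with eq show "p = q"
    by (simp add: val_def prod_eq_iff)
qed

lemma val_eq_iff: "val p = val q \<longleftrightarrow> p = q"
  using inj_val by (simp add: inj_eq)

lemma open_contains_rat:
  assumes "open V" "V \<noteq> {}" "finite F"
  obtains q where "real_of_rat q \<in> V" "q \<notin> F"
proof -
  have "infinite V"
    using assms(1,2) by (auto dest: finite_imp_not_open)
  then have "V - of_rat ` F \<noteq> {}"
    using assms(3) by (metis Diff_eq_empty_iff finite_imageI finite_subset)
  moreover have "open (V - of_rat ` F)"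
    using assms(1,3) by (simp add: finite_imp_closed open_Diff)
  ultimately obtain x e where "e > 0" "ball x e \<subseteq> V - of_rat ` F"
    by (meson ex_in_conv openE)
  moreover obtain q where "x < real_of_rat q" "real_of_rat q < x + e"
    using of_rat_dense [of x "x + e"] \<open>e > 0\<close> by auto
  ultimately have "real_of_rat q \<in> V - of_rat ` F"
    by (auto simp: dist_real_def subset_iff)
  with that show thesis by blast
qed

section \<open>Open sets of the Bing and Ritter spaces in terms of orbits\<close>

definition cell :: "real set \<Rightarrow> (rat \<times> rat) set" where
  "cell V = {p \<in> bing_set. val p \<in> V \<and> val (conjugate p) \<in> V}"

lemma cell_mono: "V \<subseteq> W \<Longrightarrow> cell V \<subseteq> cell W"
  by (auto simp: cell_def)

lemma axis_mem_cell: "(q, 0) \<in> cell V \<longleftrightarrow> real_of_rat q \<in> V"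
  by (simp add: cell_def val_def conjugate_def mem_bing_set)

lemma balls_subset_open:
  assumes "open V" "x \<in> V" "y \<in> V"
  obtains e :: real where "e > 0" "ball x e \<union> ball y e \<subseteq> (V :: real set)"
proof -
  obtain c where c: "c > 0" "ball x c \<subseteq> V"
    using assms open_contains_ball by blast
  obtain d where d: "d > 0" "ball y d \<subseteq> V"
    using assms open_contains_ball by blast
  have "ball x (min c d) \<union> ball y (min c d) \<subseteq> V"
    using c d by (auto simp: subset_iff)
  with c d that [of "min c d"] show thesis by simp
qed

lemma openin_bing_iff:
  "openin bing_space U \<longleftrightarrow> U \<subseteq> bing_set \<and>
    (\<forall>p\<in>U. \<exists>\<epsilon>>0. \<forall>q. real_of_rat q \<in> ball (val p) \<epsilon> \<union> ball (val (conjugate p)) \<epsilon> \<longrightarrow> (q, 0) \<in> U)"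
proof -
  have "bing_basic c \<epsilon> = {p. snd p = 0 \<and> real_of_rat (fst p) \<in> ball c \<epsilon>}" for c \<epsilon>
    by (auto simp: bing_basic_def mem_bing_set dist_real_def abs_minus_commute)
  then have "bing_basic c \<epsilon> \<union> bing_basic d \<epsilon> \<subseteq> U \<longleftrightarrow>
      (\<forall>q. real_of_rat q \<in> ball c \<epsilon> \<union> ball d \<epsilon> \<longrightarrow> (q, 0) \<in> U)" for c d \<epsilon>
    by auto
  then show ?thesis
    unfolding openin_bing_space bing_open_def
    by (simp add: split_beta val_def conjugate_def of_rat_minus Un_commute)
qed

lemma openin_cell:
  assumes "open V"
  shows "openin bing_space (cell V)"
  unfolding openin_bing_iff
proof (intro conjI ballI)
  show "cell V \<subseteq> bing_set" by (auto simp: cell_def)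
next
  fix p assume "p \<in> cell V"
  then obtain e where "e > 0" "ball (val p) e \<union> ball (val (conjugate p)) e \<subseteq> V"
    using balls_subset_open [OF assms] unfolding cell_def by blast
  then show "\<exists>\<epsilon>>0. \<forall>q. real_of_rat q \<in> ball (val p) \<epsilon> \<union> ball (val (conjugate p)) \<epsilon> \<longrightarrow> (q, 0) \<in> cell V"
    unfolding axis_mem_cell by blast
qed

lemma open_subset_closure_if_rats:
  assumes "open V" "\<And>q. real_of_rat q \<in> V \<Longrightarrow> real_of_rat q \<in> closure W"
  shows "V \<subseteq> closure W"
proof
  fix x assume x: "x \<in> V"
  have "x \<in> closure (closure W)"
    unfolding closure_iff_nhds_not_empty
  proof (intro allI impI)
    fix A T assume "T \<subseteq> A" "open T" "x \<in> T"
    then obtain q where "real_of_rat q \<in> T \<inter> V"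
      using open_contains_rat [of "T \<inter> V" "{}"] x assms(1) by blast
    then show "closure W \<inter> A \<noteq> {}" using assms(2) \<open>T \<subseteq> A\<close> by blast
  qed
  then show "x \<in> closure W" by simp
qed

text \<open>An axis point in the Bing closure of \<open>cell V\<close> has its coordinate in
  \<open>closure V\<close>. If \<open>p\<close> is interior to that closure, the rationals near both
  of its values lie in \<open>closure V\<close>, hence so do two whole intervals, and these lie in
  \<open>interior (closure V) = V\<close>.\<close>

lemma regular_openin_cell:
  assumes "interior (closure V) = V"
  shows "regular_openin bing_space (cell V)"
proof -
  have "open V" using assms by (metis open_interior)
  let ?U = "bing_space interior_of (bing_space closure_of cell V)"
  have "cell V \<subseteq> bing_set" by (auto simp: cell_def)
  then have "cell V \<subseteq> ?U"
    using openin_cell [OF \<open>open V\<close>] by (simp add: closure_of_subset interior_of_maximal)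
  moreover have "?U \<subseteq> cell V"
  proof
    fix p assume p: "p \<in> ?U"
    have axis: "real_of_rat q \<in> closure V" if "(q, 0) \<in> bing_space closure_of cell V" for q
      unfolding closure_iff_nhds_not_empty
    proof (intro allI impI)
      fix A T assume T: "T \<subseteq> A" "open T" "real_of_rat q \<in> T"
      then have "(q, 0) \<in> cell T" by (simp add: axis_mem_cell)
      with that openin_cell [OF \<open>open T\<close>] obtain r where "r \<in> cell V" "r \<in> cell T"
        unfolding in_closure_of by blast
      then show "V \<inter> A \<noteq> {}" using T by (auto simp: cell_def)
    qed
    have "openin bing_space ?U" by simp
    with p obtain e where e: "e > 0"
        "\<And>q. real_of_rat q \<in> ball (val p) e \<union> ball (val (conjugate p)) e \<Longrightarrow> (q, 0) \<in> ?U"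
      unfolding openin_bing_iff by meson
    have "ball (val p) e \<union> ball (val (conjugate p)) e \<subseteq> closure V"
    proof (rule open_subset_closure_if_rats)
      show "real_of_rat q \<in> closure V"
        if "real_of_rat q \<in> ball (val p) e \<union> ball (val (conjugate p)) e" for q
        using axis [OF subsetD [OF interior_of_subset e(2) [OF that]]] .
    qed auto
    then have "ball (val p) e \<union> ball (val (conjugate p)) e \<subseteq> V"
      using interior_maximal [of _ "closure V"] assms by blast
    moreover have "p \<in> bing_set"
      using p interior_of_subset_topspace by fastforce
    ultimately show "p \<in> cell V"
      using \<open>e > 0\<close> by (auto simp: cell_def)
  qed
  ultimately show ?thesis
    using \<open>cell V \<subseteq> bing_set\<close> by (simp add: regular_openin_def)
qed

text \<open>Bing openness only puts axis points near the two values of \<open>p\<close> into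
  \<open>U\<close>. Every orbit inside the two intervals is a limit of such axis points, so the open
  set \<open>cell V\<close> lies in the closure of \<open>U\<close>, and regularity puts it into
  \<open>U\<close>.\<close>

lemma regular_openin_contains_cell:
  assumes "regular_openin bing_space U" "p \<in> U"
  shows "\<exists>\<epsilon>>0. cell (ball (val p) \<epsilon> \<union> ball (val (conjugate p)) \<epsilon>) \<subseteq> U"
proof -
  have U: "U = bing_space interior_of (bing_space closure_of U)"
    using assms(1) by (simp add: regular_openin_def)
  then have "openin bing_space U" by (metis openin_interior_of)
  then obtain e where e: "e > 0"
      "\<And>q. real_of_rat q \<in> ball (val p) e \<union> ball (val (conjugate p)) e \<Longrightarrow> (q, 0) \<in> U"
    using assms(2) unfolding openin_bing_iff by meson
  define V where "V = ball (val p) e \<union> ball (val (conjugate p)) e"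
  have "open V" by (auto simp: V_def)
  have "cell V \<subseteq> bing_space closure_of U"
  proof
    fix q assume q: "q \<in> cell V"
    show "q \<in> bing_space closure_of U"
      unfolding in_closure_of
    proof (intro conjI allI impI)
      show "q \<in> topspace bing_space" using q by (simp add: cell_def)
    next
      fix T assume T: "q \<in> T \<and> openin bing_space T"
      then obtain d where d: "d > 0"
          "\<And>r. real_of_rat r \<in> ball (val q) d \<union> ball (val (conjugate q)) d \<Longrightarrow> (r, 0) \<in> T"
        unfolding openin_bing_iff by meson
      have "open (ball (val q) d \<inter> V)" "val q \<in> ball (val q) d \<inter> V"
        using q d(1) \<open>open V\<close> by (auto simp: cell_def)
      then obtain r where "real_of_rat r \<in> ball (val q) d \<inter> V"
        using open_contains_rat [of "ball (val q) d \<inter> V" "{}"] by blast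
      then have "(r, 0) \<in> U" "(r, 0) \<in> T"
        using d(2) e(2) by (auto simp: V_def)
      then show "\<exists>y. y \<in> U \<and> y \<in> T" by blast
    qed
  qed
  then have "cell V \<subseteq> U"
    using U interior_of_maximal openin_cell [OF \<open>open V\<close>] by metis
  with \<open>e > 0\<close> show ?thesis by (auto simp: V_def)
qed

lemma openin_ritter_iff:
  "openin ritter_space U \<longleftrightarrow> U \<subseteq> bing_set \<and>
    (\<forall>p\<in>U. \<exists>\<epsilon>>0. cell (ball (val p) \<epsilon> \<union> ball (val (conjugate p)) \<epsilon>) \<subseteq> U)"
proof (intro iffI conjI ballI)
  assume U: "openin ritter_space U"
  then show "U \<subseteq> bing_set" by (metis openin_subset topspace_ritter_space)
  fix p assume "p \<in> U"
  with U obtain W where "regular_openin bing_space W" "p \<in> W" "W \<subseteq> U"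
    unfolding openin_ritter_space arbitrary_union_of_alt by blast
  then show "\<exists>\<epsilon>>0. cell (ball (val p) \<epsilon> \<union> ball (val (conjugate p)) \<epsilon>) \<subseteq> U"
    using regular_openin_contains_cell by (meson order_trans)
next
  assume U: "U \<subseteq> bing_set \<and>
    (\<forall>p\<in>U. \<exists>\<epsilon>>0. cell (ball (val p) \<epsilon> \<union> ball (val (conjugate p)) \<epsilon>) \<subseteq> U)"
  show "openin ritter_space U"
    unfolding openin_ritter_space arbitrary_union_of_alt
  proof
    fix p assume p: "p \<in> U"
    with U obtain e where e: "e > 0" "cell (ball (val p) e \<union> ball (val (conjugate p)) e) \<subseteq> U"
      by blast
    \<comment> \<open>Two open balls may touch, and then their union is not regular open. The
      interior of a closed set always is.\<close>
    define K where "K = cball (val p) (e/2) \<union> cball (val (conjugate p)) (e/2)"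
    have "ball (val p) (e/2) \<union> ball (val (conjugate p)) (e/2) \<subseteq> interior K"
      unfolding K_def by (intro interior_maximal) (auto simp: mem_ball)
    then have "val p \<in> interior K" "val (conjugate p) \<in> interior K"
      using e(1) by (auto simp: subset_iff)
    then have "p \<in> cell (interior K)"
      using p U unfolding cell_def by blast
    moreover have "regular_openin bing_space (cell (interior K))"
    proof (rule regular_openin_cell)
      have "closure (interior K) \<subseteq> K"
        by (intro closure_minimal interior_subset) (auto simp: K_def)
      then show "interior (closure (interior K)) = interior K"
        by (simp add: closure_subset interior_maximal interior_mono subset_antisym)
    qed
    moreover have "interior K \<subseteq> ball (val p) e \<union> ball (val (conjugate p)) e"
      using interior_subset [of K] e(1) by (auto simp: K_def dist_real_def subset_iff)
    then have "cell (interior K) \<subseteq> U"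
      using cell_mono e(2) by blast
    ultimately show "\<exists>W. regular_openin bing_space W \<and> p \<in> W \<and> W \<subseteq> U"
      by blast
  qed
qed

lemma openin_ritter_cell:
  assumes "open V"
  shows "openin ritter_space (cell V)"
  unfolding openin_ritter_iff
proof (intro conjI ballI)
  show "cell V \<subseteq> bing_set" by (auto simp: cell_def)
next
  fix p assume "p \<in> cell V"
  then obtain e where "e > 0" "ball (val p) e \<union> ball (val (conjugate p)) e \<subseteq> V"
    using balls_subset_open [OF assms] unfolding cell_def by blast
  then show "\<exists>\<epsilon>>0. cell (ball (val p) \<epsilon> \<union> ball (val (conjugate p)) \<epsilon>) \<subseteq> cell V"
    using cell_mono by blast
qed

subsection \<open>Collapsing finitely many orbits\<close>

text \<open>The quotient of the plane that identifies \<open>p\<close> with \<open>conjugate p\<close> for \<open>p \<in> A\<close> is represented by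
  a set of representatives; its clopen sets are the traces of the sets saturated under the
  identification.\<close>

definition collapse :: "(rat \<times> rat) set \<Rightarrow> (rat \<times> rat) set" where
  "collapse A = - (conjugate ` A - A)"

definition flip :: "(rat \<times> rat) set \<Rightarrow> rat \<times> rat \<Rightarrow> rat \<times> rat" where
  "flip A p = (if p \<in> A then p else conjugate p)"

definition saturated :: "(rat \<times> rat) set \<Rightarrow> (rat \<times> rat) set \<Rightarrow> bool" where
  "saturated A W \<longleftrightarrow> (\<forall>p\<in>A. p \<in> W \<longleftrightarrow> conjugate p \<in> W)"

definition clopens :: "(rat \<times> rat) set \<Rightarrow> (rat \<times> rat) set set" where
  "clopens A = {W \<inter> collapse A | W. saturated A W \<and>
     (\<exists>V. open V \<and> W = val -` V) \<and> (\<exists>V. open V \<and> - W = val -` V)}"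

text \<open>Two intervals are needed because a saturated neighbourhood of a point of
  \<open>A\<close> also surrounds its conjugate, whose value may be far away. Rational offsets from
  \<open>t\<close> keep the family countable.\<close>

definition boxes :: "real \<Rightarrow> (rat \<times> rat) set set" where
  "boxes t = range (\<lambda>(a, b, c, d). val -` ({t + real_of_rat a<..<t + real_of_rat b} \<union>
     {t + real_of_rat c<..<t + real_of_rat d}))"

lemma boxesE:
  assumes "W \<in> boxes t"
  obtains a b c d where "W = val -` ({t + real_of_rat a<..<t + real_of_rat b} \<union>
     {t + real_of_rat c<..<t + real_of_rat d})"
proof -
  from assms obtain z where "W = (case z of (a, b, c, d) \<Rightarrow>
      val -` ({t + real_of_rat a<..<t + real_of_rat b} \<union> {t + real_of_rat c<..<t + real_of_rat d}))"
    unfolding boxes_def by blast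
  then show thesis by (cases z) (simp only: prod.case that)
qed

definition clopen_base :: "real \<Rightarrow> (rat \<times> rat) set \<Rightarrow> (rat \<times> rat) set set" where
  "clopen_base t A = {W \<inter> collapse A | W. W \<in> boxes t \<and> saturated A W}"

text \<open>The counterpart of \<open>cell\<close> after the collapse: it leads from sets in the
  collapsed space back to sets in the Ritter space.\<close>

definition orbits_in :: "(rat \<times> rat) set \<Rightarrow> (rat \<times> rat) set \<Rightarrow> (rat \<times> rat) set" where
  "orbits_in A U = {p \<in> bing_set. p \<in> U \<and> flip A p \<in> U}"

lemma countable_clopen_base: "countable (clopen_base t A)"
proof -
  have "countable (boxes t)" by (simp add: boxes_def)
  moreover have "clopen_base t A \<subseteq> (\<lambda>W. W \<inter> collapse A) ` boxes t"
    by (auto simp: clopen_base_def)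
  ultimately show ?thesis
    by (meson countable_image countable_subset)
qed

lemma clopensI:
  assumes "saturated A W" "open V" "W = val -` V" "open V'" "- W = val -` V'"
  shows "W \<inter> collapse A \<in> clopens A"
  using assms unfolding clopens_def by blast

lemma clopensE:
  assumes "U \<in> clopens A"
  obtains W V V' where "U = W \<inter> collapse A" "saturated A W"
    "open V" "W = val -` V" "open V'" "- W = val -` V'"
  using assms unfolding clopens_def by blast

text \<open>A translate of the rationals that misses the countable range of \<open>val\<close>: intervals with
  endpoints there cut out clopen sets.\<close>

lemma ex_cut: "\<exists>t. \<forall>p q. val p \<noteq> t + real_of_rat q"
proof -
  have "countable (range val)" by simp
  then obtain t where t: "t \<notin> range val"
    using uncountable_UNIV_real by (metis UNIV_eq_I)
  have "val p \<noteq> t + real_of_rat q" for p q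
  proof
    assume "val p = t + real_of_rat q"
    then have "val (fst p - q, snd p) = t" by (simp add: val_def of_rat_diff)
    with t show False by blast
  qed
  then show ?thesis by blast
qed

lemma clopen_base_subset:
  assumes t: "\<forall>p q. val p \<noteq> t + real_of_rat q"
  shows "clopen_base t A \<subseteq> clopens A"
proof
  fix U assume "U \<in> clopen_base t A"
  then obtain W where "W \<in> boxes t" and W1: "U = W \<inter> collapse A" "saturated A W"
    unfolding clopen_base_def by blast
  then obtain a b c d where W2: "W = val -` ({t + real_of_rat a<..<t + real_of_rat b} \<union>
       {t + real_of_rat c<..<t + real_of_rat d})" (is "_ = val -` ?V")
    by (elim boxesE)
  \<comment> \<open>As \<open>val\<close> misses the endpoints, closing the intervals does not
    change the preimage.\<close>
  let ?K = "{t + real_of_rat a..t + real_of_rat b} \<union> {t + real_of_rat c..t + real_of_rat d}"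
  have "t + real_of_rat q \<le> val p \<longleftrightarrow> t + real_of_rat q < val p"
    "val p \<le> t + real_of_rat q \<longleftrightarrow> val p < t + real_of_rat q" for p q
    using t by (metis order_le_less)+
  then have "val p \<in> ?K \<longleftrightarrow> val p \<in> ?V" for p
    by simp
  then have "- W = val -` (- ?K)"
    unfolding W2 by blast
  moreover have "open ?V" "open (- ?K)"
    by (auto intro!: open_Compl)
  ultimately show "U \<in> clopens A"
    using clopensI [OF W1(2) _ W2] W1(1) by blast
qed

text \<open>In the applications \<open>F\<close> contains \<open>A\<close> and its conjugates. A box
  that avoids the irrelevant ones among these is saturated.\<close>

lemma ex_box:
  assumes "finite F"
    and "\<epsilon> > 0"
  obtains W where "W \<in> boxes t" "p \<in> W" "q \<in> W" "W \<inter> F \<subseteq> {p, q}"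
    "W \<subseteq> val -` (ball (val p) \<epsilon> \<union> ball (val q) \<epsilon>)"
proof -
  have side: "\<exists>a b. val p \<in> {t + real_of_rat a<..<t + real_of_rat b} \<and>
      {t + real_of_rat a<..<t + real_of_rat b} \<subseteq> ball (val p) \<epsilon> \<and>
      (\<forall>x\<in>F. val x \<in> {t + real_of_rat a<..<t + real_of_rat b} \<longrightarrow> x = p)" for p
  proof -
    obtain d where d: "d > 0" "\<forall>y\<in>val ` F. y \<noteq> val p \<longrightarrow> d \<le> dist (val p) y"
      using finite_set_avoid [of "val ` F" "val p"] assms(1) by auto
    define e where "e = min d \<epsilon>"
    have "e > 0" using d assms(2) by (simp add: e_def)
    obtain a where a: "val p - e - t < real_of_rat a" "real_of_rat a < val p - t"
      using of_rat_dense [of "val p - e - t" "val p - t"] \<open>e > 0\<close> by auto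
    obtain b where b: "val p - t < real_of_rat b" "real_of_rat b < val p + e - t"
      using of_rat_dense [of "val p - t" "val p + e - t"] \<open>e > 0\<close> by auto
    have ball: "{t + real_of_rat a<..<t + real_of_rat b} \<subseteq> ball (val p) e"
      using a b by (auto simp: dist_real_def)
    moreover have "x = p" if "x \<in> F" "val x \<in> ball (val p) e" for x
    proof (rule ccontr)
      assume "x \<noteq> p"
      then have "d \<le> dist (val p) (val x)" using d(2) that(1) by (simp add: val_eq_iff)
      then show False using that(2) by (simp add: e_def)
    qed
    moreover have "ball (val p) e \<subseteq> ball (val p) \<epsilon>" by (auto simp: e_def)
    ultimately show ?thesis
      using a b by (intro exI [of _ a] exI [of _ b]) auto
  qed
  from side [of p] obtain a b where ab: "val p \<in> {t + real_of_rat a<..<t + real_of_rat b}"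
      "{t + real_of_rat a<..<t + real_of_rat b} \<subseteq> ball (val p) \<epsilon>"
      "\<forall>x\<in>F. val x \<in> {t + real_of_rat a<..<t + real_of_rat b} \<longrightarrow> x = p" by blast
  from side [of q] obtain c d where cd: "val q \<in> {t + real_of_rat c<..<t + real_of_rat d}"
      "{t + real_of_rat c<..<t + real_of_rat d} \<subseteq> ball (val q) \<epsilon>"
      "\<forall>x\<in>F. val x \<in> {t + real_of_rat c<..<t + real_of_rat d} \<longrightarrow> x = q" by blast
  define W where "W = val -` ({t + real_of_rat a<..<t + real_of_rat b} \<union>
      {t + real_of_rat c<..<t + real_of_rat d})"
  show thesis
  proof
    show "W \<in> boxes t"
      unfolding boxes_def W_def by (rule image_eqI [of _ _ "(a, b, c, d)"]) auto
    show "p \<in> W" "q \<in> W" using ab(1) cd(1) unfolding W_def by blast+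
    show "W \<inter> F \<subseteq> {p, q}" using ab(3) cd(3) unfolding W_def by blast
    show "W \<subseteq> val -` (ball (val p) \<epsilon> \<union> ball (val q) \<epsilon>)"
      using ab(2) cd(2) unfolding W_def by blast
  qed
qed

lemma saturatedI:
  assumes "p \<in> W" "conjugate p \<in> W" "W \<inter> (A \<union> conjugate ` A) \<subseteq> {p, conjugate p}"
  shows "saturated A W"
  unfolding saturated_def
proof (intro ballI iffI)
  fix a assume a: "a \<in> A" "a \<in> W"
  then have "a = p \<or> a = conjugate p" using assms(3) by blast
  then show "conjugate a \<in> W" using assms(1,2) by auto
next
  fix a assume a: "a \<in> A" "conjugate a \<in> W"
  then have "conjugate a = p \<or> conjugate a = conjugate p" using assms(3) by blast
  then have "a = conjugate p \<or> a = p" by (metis conjugate_conjugate)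
  then show "a \<in> W" using assms(1,2) by auto
qed

lemma ex_axis_point:
  assumes "open V" "V \<noteq> {}" "finite F"
  obtains x where "val x \<in> V" "conjugate x = x" "x \<notin> F"
proof -
  obtain a where "real_of_rat a \<in> V" "a \<notin> fst ` F"
    using open_contains_rat assms by (metis finite_imageI)
  then show thesis
    by (intro that [of "(a, 0)"]) (auto simp: val_def conjugate_def image_iff)
qed

text \<open>The equations \<open>a + b / sqrt 3 = u\<close> and \<open>a - b / sqrt 3 = v\<close>
  have the real solution \<open>a = (u + v) / 2\<close>, \<open>b = sqrt 3 * (u - v) / 2\<close>;
  rational approximations of it do the job. Taking \<open>b\<close> nonzero keeps the point off the
  axis, and the choice of \<open>a\<close> avoids \<open>F\<close>.\<close>

lemma ex_conjugate_pair:
  assumes V: "open V" "V \<noteq> {}" and W: "open W" "W \<noteq> {}" and F: "finite F"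
  obtains x where "val x \<in> V" "val (conjugate x) \<in> W" "conjugate x \<noteq> x" "x \<notin> F"
proof -
  obtain u v where "u \<in> V" "v \<in> W" using V W by blast
  then obtain c d where c: "c > 0" "ball u c \<subseteq> V" and d: "d > 0" "ball v d \<subseteq> W"
    using V W by (meson openE)
  define e where "e = min c d / 2"
  have e: "e > 0" using c d by (simp add: e_def)
  obtain a where a: "real_of_rat a \<in> ball ((u + v) / 2) e" "a \<notin> fst ` F"
    using open_contains_rat [of "ball ((u + v) / 2) e" "fst ` F"] e F by auto
  obtain b where b: "real_of_rat b \<in> ball (sqrt 3 * ((u - v) / 2)) e" "b \<notin> {0}"
    using open_contains_rat [of "ball (sqrt 3 * ((u - v) / 2)) e" "{0}"] e by auto
  have "1 < sqrt (3::real)" by simp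
  have "\<bar>real_of_rat b / sqrt 3 - (u - v) / 2\<bar> = \<bar>real_of_rat b - sqrt 3 * ((u - v) / 2)\<bar> / sqrt 3"
  proof -
    have "real_of_rat b / sqrt 3 - (u - v) / 2 = (real_of_rat b - sqrt 3 * ((u - v) / 2)) / sqrt 3"
      by (simp add: diff_divide_distrib)
    then show ?thesis by (simp add: abs_divide)
  qed
  also have "\<dots> \<le> \<bar>real_of_rat b - sqrt 3 * ((u - v) / 2)\<bar>"
    using \<open>1 < sqrt 3\<close> by (simp add: divide_le_eq mult_le_cancel_left1)
  also have "\<dots> < e" using b(1) by (simp add: dist_real_def)
  finally have b': "\<bar>real_of_rat b / sqrt 3 - (u - v) / 2\<bar> < e" .
  have a': "\<bar>real_of_rat a - (u + v) / 2\<bar> < e" using a(1) by (simp add: dist_real_def)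
  have "val (a, b) = real_of_rat a + real_of_rat b / sqrt 3"
    "val (conjugate (a, b)) = real_of_rat a - real_of_rat b / sqrt 3"
    by (simp_all add: val_def conjugate_def of_rat_minus)
  moreover have "2 * e \<le> c" "2 * e \<le> d" by (simp_all add: e_def)
  ultimately have "\<bar>val (a, b) - u\<bar> < c" "\<bar>val (conjugate (a, b)) - v\<bar> < d"
    using a' b' by argo+
  then have "val (a, b) \<in> V" "val (conjugate (a, b)) \<in> W"
    using c(2) d(2) by (auto simp: dist_real_def subset_iff)
  then show thesis
    using a(2) b(2) by (intro that [of "(a, b)"]) (auto simp: conjugate_eq_self image_iff)
qed

context
  fixes A :: "(rat \<times> rat) set"
  assumes A: "finite A" "A \<subseteq> bing_set"
begin

text \<open>The discarded points are conjugates of points of the half-plane; one that lies in the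
  half-plane itself is on the axis and equals its conjugate, so it belongs to \<open>A\<close> and
  is kept.\<close>

lemma bing_set_subset_collapse: "bing_set \<subseteq> collapse A"
proof
  fix p assume p: "p \<in> bing_set"
  have "p \<in> A" if "p = conjugate a" "a \<in> A" for a
  proof -
    have "snd p = - snd a" "snd p \<ge> 0" "snd a \<ge> 0"
      using that p A(2) by (auto simp: conjugate_def mem_bing_set)
    then have "conjugate a = a" by (simp add: conjugate_eq_self)
    with that show ?thesis by simp
  qed
  then show "p \<in> collapse A" by (auto simp: collapse_def)
qed

lemma flip_collapse:
  assumes "p \<in> collapse A"
  shows "flip A p \<in> collapse A" "flip A (flip A p) = p"
  using assms by (auto simp: flip_def collapse_def) (metis conjugate_conjugate image_eqI)+

lemma involution_space_collapse: "involution_space (collapse A) (flip A) (clopens A)"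
proof
  show "countable (collapse A)" by simp
  have "(0, 0) \<in> bing_set" by (simp add: mem_bing_set)
  then show "collapse A \<noteq> {}" using bing_set_subset_collapse by blast
  show "U \<subseteq> collapse A" if "U \<in> clopens A" for U
    using that by (auto elim: clopensE)
  show "collapse A \<in> clopens A"
    using clopensI [of A UNIV UNIV "{}"] by (simp add: saturated_def)
  show "collapse A - U \<in> clopens A" if "U \<in> clopens A" for U
  proof -
    from that obtain W V V' where U: "U = W \<inter> collapse A" "saturated A W"
      "open V" "W = val -` V" "open V'" "- W = val -` V'" by (rule clopensE)
    then have "collapse A - U = - W \<inter> collapse A" "saturated A (- W)"
      by (auto simp: saturated_def)
    moreover have "- (- W) = val -` V" using U(4) by simp
    ultimately show ?thesis
      using clopensI [OF _ U(5,6,3)] by simp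
  qed
  show "U1 \<inter> U2 \<in> clopens A" if "U1 \<in> clopens A" "U2 \<in> clopens A" for U1 U2
  proof -
    from that(1) obtain W V V' where U: "U1 = W \<inter> collapse A" "saturated A W"
      "open V" "W = val -` V" "open V'" "- W = val -` V'" by (rule clopensE)
    from that(2) obtain X Y Y' where X: "U2 = X \<inter> collapse A" "saturated A X"
      "open Y" "X = val -` Y" "open Y'" "- X = val -` Y'" by (rule clopensE)
    have "U1 \<inter> U2 = W \<inter> X \<inter> collapse A" "saturated A (W \<inter> X)"
      using U(1,2) X(1,2) by (auto simp: saturated_def)
    moreover have "W \<inter> X = val -` (V \<inter> Y)" "- (W \<inter> X) = val -` (V' \<union> Y')"
      using U(4,6) X(4,6) by auto
    ultimately show ?thesis
      using clopensI [of A "W \<inter> X" "V \<inter> Y" "V' \<union> Y'"] U(3,5) X(3,5) by auto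
  qed
  show "\<exists>U\<in>clopens A. x \<in> U \<and> U \<inter> F \<subseteq> {x}" if x: "x \<in> collapse A" and F: "finite F" for x F
  proof -
    obtain t where t: "\<forall>p q. val p \<noteq> t + real_of_rat q" using ex_cut by blast
    \<comment> \<open>For \<open>x\<close> in \<open>A\<close> a saturated box must contain the
      identified partner as well. That partner is not a second point of the collapsed space: it is
      either discarded or equal to \<open>x\<close>.\<close>
    define y where "y = (if x \<in> A then conjugate x else x)"
    have "finite (F \<union> A \<union> conjugate ` A)" using F A by simp
    then obtain W where W: "W \<in> boxes t" "x \<in> W" "y \<in> W" "W \<inter> (F \<union> A \<union> conjugate ` A) \<subseteq> {x, y}"
      using ex_box zero_less_one by metis
    have y: "y = x" if "y \<in> collapse A"
    proof (cases "x \<in> A")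
      case True
      with that have "conjugate x \<in> A" by (auto simp: y_def collapse_def)
      with True have "conjugate x = x"
        using subsetD [OF A(2), of x] subsetD [OF A(2), of "conjugate x"]
        by (auto simp: mem_bing_set conjugate_def prod_eq_iff)
      then show ?thesis by (simp add: y_def)
    qed (simp add: y_def)
    have sat: "saturated A W"
    proof (cases "x \<in> A")
      case True
      then show ?thesis
        using W(2-4) by (intro saturatedI [of x]) (auto simp: y_def)
    next
      case False
      then have "W \<inter> (A \<union> conjugate ` A) = {}"
        using x W(4) by (auto simp: y_def collapse_def)
      then show ?thesis by (auto simp: saturated_def)
    qed
    have "W \<inter> collapse A \<in> clopen_base t A" using W(1) sat by (auto simp: clopen_base_def)
    then show ?thesis
      using clopen_base_subset [OF t] W(2,4) x y by (intro bexI [of _ "W \<inter> collapse A"]) auto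
  qed
  show "flip A x \<in> collapse A" "flip A (flip A x) = x" if "x \<in> collapse A" for x
    using flip_collapse that by auto
  have fin: "finite (F \<union> A \<union> conjugate ` A)" if "finite F" for F
    using that A by simp
  \<comment> \<open>Points avoiding \<open>A\<close> and its conjugates survive the collapse, and
    there \<open>flip A\<close> is the plain conjugation.\<close>
  have coll: "x \<in> collapse A" if "x \<notin> conjugate ` A" for x
    using that by (auto simp: collapse_def)
  show "\<exists>x\<in>U - F. flip A x = x" if "U \<in> clopens A" "U \<noteq> {}" "finite F" for U F
  proof -
    have F: "finite (F \<union> A \<union> conjugate ` A)" using fin that(3) .
    from that(1) obtain W V V' where U: "U = W \<inter> collapse A" "saturated A W"
      "open V" "W = val -` V" "open V'" "- W = val -` V'" by (rule clopensE)
    have ne: "V \<noteq> {}" using that(2) U(1,4) by auto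
    obtain x where "val x \<in> V" "conjugate x = x" "x \<notin> F \<union> A \<union> conjugate ` A"
      by (rule ex_axis_point [OF U(3) ne F])
    moreover from this have "x \<in> collapse A" using coll by blast
    ultimately show ?thesis using U by (intro bexI [of _ x]) (auto simp: flip_def)
  qed
  show "\<exists>x\<in>U1 - F. flip A x \<in> U2 \<and> flip A x \<noteq> x"
    if "U1 \<in> clopens A" "U2 \<in> clopens A" "U1 \<noteq> {}" "U2 \<noteq> {}" "finite F" for U1 U2 F
  proof -
    from that(1) obtain W V V' where U: "U1 = W \<inter> collapse A" "saturated A W"
      "open V" "W = val -` V" "open V'" "- W = val -` V'" by (rule clopensE)
    from that(2) obtain X Y Y' where X: "U2 = X \<inter> collapse A" "saturated A X"
      "open Y" "X = val -` Y" "open Y'" "- X = val -` Y'" by (rule clopensE)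
    have F: "finite (F \<union> A \<union> conjugate ` A)" using fin that(5) .
    have ne: "V \<noteq> {}" "Y \<noteq> {}" using that(3,4) U(1,4) X(1,4) by auto
    obtain x where x: "val x \<in> V" "val (conjugate x) \<in> Y" "conjugate x \<noteq> x"
      "x \<notin> F \<union> A \<union> conjugate ` A"
      by (rule ex_conjugate_pair [OF U(3) ne(1) X(3) ne(2) F])
    then have "x \<in> collapse A" and flip: "flip A x = conjugate x"
      using coll by (auto simp: flip_def)
    moreover from this have "conjugate x \<in> collapse A"
      using flip_collapse(1) [of x] by simp
    ultimately show ?thesis
      using x U X by (intro bexI [of _ x]) auto
  qed
qed

text \<open>For \<open>p\<close> in \<open>A\<close> saturation makes membership of \<open>p\<close>
  and of \<open>conjugate p\<close> equivalent, so demanding only \<open>p\<close> loses nothing.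
  This is why collapsing leaves the Ritter topology unchanged.\<close>

lemma orbits_in_Int_collapse:
  assumes "saturated A (val -` V)"
  shows "orbits_in A (val -` V \<inter> collapse A) = cell V"
proof -
  have "p \<in> collapse A" "flip A p \<in> collapse A" if "p \<in> bing_set" for p
    using that bing_set_subset_collapse flip_collapse(1) by blast+
  moreover have "val p \<in> V \<and> val (flip A p) \<in> V \<longleftrightarrow> val p \<in> V \<and> val (conjugate p) \<in> V" for p
    using assms by (auto simp: flip_def saturated_def)
  ultimately show ?thesis
    unfolding orbits_in_def cell_def by blast
qed

lemma openin_ritter_orbits_in:
  assumes "U \<in> clopens A"
  shows "openin ritter_space (orbits_in A U)"
  using assms by (elim clopensE) (metis orbits_in_Int_collapse openin_ritter_cell)

text \<open>Saturated boxes are already fine enough, so a homeomorphism has to be controlled only on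
  a countable family of clopen sets.\<close>

lemma ritter_base:
  assumes "openin ritter_space Q" "p \<in> Q"
  obtains U where "U \<in> clopen_base t A" "p \<in> orbits_in A U" "orbits_in A U \<subseteq> Q"
proof -
  obtain e where e: "e > 0" "cell (ball (val p) e \<union> ball (val (conjugate p)) e) \<subseteq> Q"
    and p: "p \<in> bing_set"
    using assms unfolding openin_ritter_iff by blast
  have "finite (A \<union> conjugate ` A)" using A by simp
  then obtain W where W: "W \<in> boxes t" "p \<in> W" "conjugate p \<in> W"
      "W \<inter> (A \<union> conjugate ` A) \<subseteq> {p, conjugate p}"
      "W \<subseteq> val -` (ball (val p) e \<union> ball (val (conjugate p)) e)"
    using ex_box e(1) by metis
  have sat: "saturated A W"
    using saturatedI W(2-4) .
  obtain V where V: "W = val -` V" using W(1) by (elim boxesE)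
  show thesis
  proof
    show "W \<inter> collapse A \<in> clopen_base t A" using W(1) sat by (auto simp: clopen_base_def)
    have tr: "orbits_in A (W \<inter> collapse A) = cell V" using orbits_in_Int_collapse sat unfolding V by blast
    then show "p \<in> orbits_in A (W \<inter> collapse A)"
      using p W(2,3) V by (simp add: cell_def)
    have "cell V \<subseteq> cell (ball (val p) e \<union> ball (val (conjugate p)) e)"
      using W(5) unfolding V cell_def by blast
    with tr show "orbits_in A (W \<inter> collapse A) \<subseteq> Q" using e(2) by blast
  qed
qed

end

section \<open>Extension of a finite bijection to a homeomorphism\<close>

theorem ritter_extension:
  assumes A: "finite A" "A \<subseteq> bing_set" and B: "finite B" "B \<subseteq> bing_set"
    and f: "bij_betw f A B"
  shows "\<exists>h. homeomorphic_map ritter_space ritter_space h \<and> (\<forall>x\<in>A. h x = f x)"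
proof -
  obtain t where t: "\<forall>p q. val p \<noteq> t + real_of_rat q" using ex_cut by blast
  interpret X: involution_space "collapse A" "flip A" "clopens A"
    by (rule involution_space_collapse [OF A])
  interpret Y: involution_space "collapse B" "flip B" "clopens B"
    by (rule involution_space_collapse [OF B])
  interpret back_and_forth "collapse A" "flip A" "clopens A" "collapse B" "flip B" "clopens B" ..
  have sub: "bing_set \<subseteq> collapse A" "bing_set \<subseteq> collapse B"
    using bing_set_subset_collapse A B by auto
  have "f ` A \<subseteq> collapse B" "inj_on f A" "A \<subseteq> collapse A"
    using f A B sub by (auto simp: bij_betw_def)
  note f' = this
  have fixed: "flip A a = a" "flip B (f a) = f a" if "a \<in> A" for a
    using f that by (auto simp: flip_def bij_betw_def)
  note clopen_base_facts = countable_clopen_base clopen_base_subset [OF t]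
  obtain g where g: "bij_betw g (collapse A) (collapse B)"
    "\<And>x. x \<in> collapse A \<Longrightarrow> g (flip A x) = flip B (g x)" "\<And>a. a \<in> A \<Longrightarrow> g a = f a"
    and gU: "\<And>U. U \<in> clopen_base t A \<Longrightarrow> g ` U \<in> clopens B"
    and gV: "\<And>V. V \<in> clopen_base t B \<Longrightarrow> {x \<in> collapse A. g x \<in> V} \<in> clopens A"
    by (rule equivariant_bijection [OF f'(1,2) A(1) f'(3) fixed clopen_base_facts clopen_base_facts])
      blast+
  have gE: "g x \<in> collapse B" if "x \<in> collapse A" for x
    using g(1) that by (auto simp: bij_betw_def)
  have g_inj: "g x = g y \<longleftrightarrow> x = y" if "x \<in> collapse A" "y \<in> collapse A" for x y
    using g(1) that by (auto simp: bij_betw_def inj_on_eq_iff)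
  \<comment> \<open>\<open>g\<close> may leave the half-plane, so \<open>h\<close> takes the
    representative there of the orbit of \<open>g x\<close>. On \<open>A\<close> nothing changes,
    since \<open>g a = f a\<close> lies in \<open>B\<close>.\<close>
  define h where "h x = (if g x \<in> bing_set then g x else conjugate (g x))" for x
  have h_bing: "h x \<in> bing_set" for x
    by (auto simp: h_def mem_bing_set conjugate_def)
  have h_cases: "h x = g x \<or> h x = flip B (g x)" for x
    using B(2) by (auto simp: h_def flip_def)
  have orbit: "p = q" if "p \<in> bing_set" "q \<in> bing_set" "p = flip C q" for p q C
    using that by (auto simp: flip_def mem_bing_set conjugate_def prod_eq_iff split: if_splits)
  have h_inj: "x = y" if "x \<in> bing_set" "y \<in> bing_set" "h x = h y" for x y
  proof -
    have xy: "x \<in> collapse A" "y \<in> collapse A" using that sub by auto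
    then have "g x = g y \<or> g x = flip B (g y)"
      using h_cases [of x] h_cases [of y] that(3) Y.involution [OF gE]
      by metis
    then have "x = y \<or> x = flip A y"
      using xy g(2) g_inj X.involution_closed by metis
    then show ?thesis using orbit that by blast
  qed
  have h_onto: "\<exists>x\<in>bing_set. h x = y" if y: "y \<in> bing_set" for y
  proof -
    have "y \<in> g ` collapse A" using g(1) y sub by (auto simp: bij_betw_def)
    then obtain x where x: "x \<in> collapse A" "g x = y" by blast
    show ?thesis
    proof (cases "x \<in> bing_set")
      case True
      then show ?thesis using x y by (auto simp: h_def)
    next
      case False
      \<comment> \<open>A preimage in the lower half-plane is replaced by its mirror image; by
        equivariance this changes the value only within the orbit of \<open>y\<close>.\<close>
      then have "flip A x \<in> bing_set"
        using A(2) by (auto simp: flip_def mem_bing_set conjugate_def)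
      moreover have "h (flip A x) = y"
      proof -
        have "flip B (flip B y) = y" using Y.involution y sub by blast
        then have "h (flip A x) = y \<or> h (flip A x) = flip B y"
          using h_cases [of "flip A x"] g(2) [OF x(1)] x(2) by auto
        then show ?thesis using orbit [OF h_bing y] by blast
      qed
      ultimately show ?thesis by blast
    qed
  qed
  \<comment> \<open>As \<open>g\<close> maps orbits to orbits, this turns what is known about
    \<open>g\<close> on clopen sets into statements about \<open>h\<close> on basic open sets:
    \<open>gV\<close> gives continuity and \<open>gU\<close> openness.\<close>
  have orbits_in_h: "h x \<in> orbits_in B V \<longleftrightarrow> g x \<in> V \<and> g (flip A x) \<in> V" if "x \<in> bing_set" for x V
  proof -
    have x: "x \<in> collapse A" using that sub by blast
    show ?thesis
      using h_cases [of x] h_bing [of x] Y.involution [OF gE [OF x]] g(2) [OF x]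
      by (auto simp: orbits_in_def)
  qed
  have "homeomorphic_map ritter_space ritter_space h"
  proof (rule bijective_open_imp_homeomorphic_map)
    show "continuous_map ritter_space ritter_space h"
      unfolding continuous_map
    proof (intro conjI allI impI)
      show "h ` topspace ritter_space \<subseteq> topspace ritter_space" using h_bing by auto
      fix Q assume Q: "openin ritter_space Q"
      show "openin ritter_space {x \<in> topspace ritter_space. h x \<in> Q}"
      proof (subst openin_subopen, intro ballI)
        fix x assume "x \<in> {x \<in> topspace ritter_space. h x \<in> Q}"
        then have x: "x \<in> bing_set" "h x \<in> Q" by auto
        obtain V where V: "V \<in> clopen_base t B" "h x \<in> orbits_in B V" "orbits_in B V \<subseteq> Q"
          using ritter_base [OF B Q x(2)] .
        let ?T = "orbits_in A {x \<in> collapse A. g x \<in> V}"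
        have T: "y \<in> ?T \<longleftrightarrow> y \<in> bing_set \<and> h y \<in> orbits_in B V" for y
        proof (cases "y \<in> bing_set")
          case True
          then have "y \<in> collapse A" "flip A y \<in> collapse A"
            using sub X.involution_closed by blast+
          then show ?thesis
            using orbits_in_h [OF True, of V] True by (auto simp: orbits_in_def)
        qed (simp add: orbits_in_def)
        show "\<exists>T. openin ritter_space T \<and> x \<in> T \<and> T \<subseteq> {x \<in> topspace ritter_space. h x \<in> Q}"
          using openin_ritter_orbits_in [OF A gV [OF V(1)]] T V x by (intro exI [of _ ?T]) auto
      qed
    qed
    show "open_map ritter_space ritter_space h"
      unfolding open_map_def
    proof (intro allI impI)
      fix Q assume Q: "openin ritter_space Q"
      then have "Q \<subseteq> bing_set" by (metis openin_subset topspace_ritter_space)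
      show "openin ritter_space (h ` Q)"
      proof (subst openin_subopen, intro ballI)
        fix y assume "y \<in> h ` Q"
        then obtain x where x: "x \<in> Q" "y = h x" by blast
        obtain U where U: "U \<in> clopen_base t A" "x \<in> orbits_in A U" "orbits_in A U \<subseteq> Q"
          using ritter_base [OF A Q x(1)] .
        have "U \<subseteq> collapse A" using U(1) by (auto simp: clopen_base_def)
        then have gU_iff: "g z \<in> g ` U \<longleftrightarrow> z \<in> U" if "z \<in> collapse A" for z
          using g_inj that by blast
        have T: "h z \<in> orbits_in B (g ` U) \<longleftrightarrow> z \<in> orbits_in A U" if "z \<in> bing_set" for z
        proof -
          have "z \<in> collapse A" "flip A z \<in> collapse A"
            using that sub X.involution_closed by blast+
          then show ?thesis
            using orbits_in_h [OF that] gU_iff that by (auto simp: orbits_in_def)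
        qed
        have "orbits_in B (g ` U) \<subseteq> h ` Q"
        proof
          fix w assume w: "w \<in> orbits_in B (g ` U)"
          then have "w \<in> bing_set" by (simp add: orbits_in_def)
          then obtain z where "z \<in> bing_set" "h z = w"
            using h_onto by blast
          then show "w \<in> h ` Q" using T w U(3) by blast
        qed
        then show "\<exists>T. openin ritter_space T \<and> y \<in> T \<and> T \<subseteq> h ` Q"
          using openin_ritter_orbits_in [OF B gU [OF U(1)]] T [of x] U(2) x \<open>Q \<subseteq> bing_set\<close>
          by blast
      qed
    qed
    show "h ` topspace ritter_space = topspace ritter_space"
      unfolding topspace_ritter_space using h_bing h_onto by blast
    show "inj_on h (topspace ritter_space)"
      using h_inj by (auto intro: inj_onI)
  qed
  moreover have "h a = f a" if "a \<in> A" for a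
    using g(3) [OF that] f B(2) that by (auto simp: h_def bij_betw_def)
  ultimately show ?thesis by blast
qed

theorem corollary3:
  fixes n :: nat
  assumes "n > 0"
  shows "n_homogeneous n ritter_space"
  unfolding n_homogeneous_def topspace_ritter_space using ritter_extension by blast

end
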